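(* Let $\phi=\tilde p/p$ be an irreducible rational inner function on $\mathbb{D}^3$ of degree $(m,n,1)$ with $p(z)=p_1(z_1,z_2)+z_3p_2(z_1,z_2)$, $\tilde p(z)=z_3\tilde p_1(z_1,z_2)+\tilde p_2(z_1,z_2)$. Fix $\lambda\in\mathbb{T}$, let $q_\lambda=\lambda p_1-\tilde p_2$, and let $\Psi_\lambda=\bar\lambda\,q_\lambda/\tilde q_\lambda$. Let $\mathcal{C}_\lambda=\overline{\{\zeta\in\mathbb{T}^3\setminus\mathcal{Z}_p:\phi(\zeta)=\lambda\}}$. Then: (i) $(\mathcal{Z}_{q_\lambda}\cap\mathbb{T}^2)\times\mathbb{T}\subseteq\mathcal{C}_\lambda$; (ii) $1/\Psi_\lambda$ is a two-variable rational inner function, and $\mathcal{C}_\lambda\setminus\big((\mathcal{Z}_{q_\lambda}\cap\mathbb{T}^2)\times\mathbb{T}\big)$ is parameterized by $\tau_3=\Psi_\lambda(\tau_1,\tau_2)=\bar\lambda\frac{q_\lambda(\tau_1,\tau_2)}{\tilde q_\lambda(\tau_1,\tau_2)}$ for $(\tau_1,\tau_2)\in\mathbb{T}^2$.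
   Context: A rational inner function (RIF) on $\mathbb{D}^d$ is a rational function holomorphic on the polydisk with unimodular radial limits a.e. on $\mathbb{T}^d$; a three-variable RIF is written $\phi=\tilde p/p$ with $p$ zero-free on $\mathbb{D}^3$ and $p,\tilde p$ without common factors. For degree $(m,n,1)$, $\tilde p(z)=z_1^mz_2^nz_3\overline{p(1/\bar z_1,1/\bar z_2,1/\bar z_3)}$, and for any $q\in\mathbb{C}[z_1,z_2]$ the reflection is taken with respect to $(m,n)$: $\tilde q(z_1,z_2)=z_1^mz_2^n\overline{q(1/\bar z_1,1/\bar z_2)}$ (so $\tilde p_j$ are the reflections of $p_j$). $\mathcal{Z}_q$ denotes the zero set of $q$. *)

theory Defs
  imports "HOL-Analysis.Analysis" "HOL-Computational_Algebra.Polynomial_Factorial"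
begin

text \<open>Multivariate polynomials are represented as nested univariate polynomials.
  A two-variable polynomial q(z1,z2) has type complex poly poly: the outer variable
  is z2, the coefficients are polynomials in z1.  A three-variable polynomial
  p(z1,z2,z3) has type complex poly poly poly: outer variable z3, coefficients are
  two-variable polynomials.  These types form factorial rings, so dvd, coprime and
  irreducible have their usual algebraic meaning in C[z1,z2] resp. C[z1,z2,z3].\<close>

definition eval2 :: "complex poly poly \<Rightarrow> complex \<Rightarrow> complex \<Rightarrow> complex" where
  "eval2 Q z1 z2 = poly (map_poly (\<lambda>c. poly c z1) Q) z2"

definition eval3 :: "complex poly poly poly \<Rightarrow> complex \<Rightarrow> complex \<Rightarrow> complex \<Rightarrow> complex" where
  "eval3 P z1 z2 z3 = poly (map_poly (\<lambda>Q. eval2 Q z1 z2) P) z3"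

definition refl_gen :: "nat \<Rightarrow> ('a::zero \<Rightarrow> 'b::comm_monoid_add) \<Rightarrow> 'a poly \<Rightarrow> 'b poly" where
  "refl_gen k f P = (\<Sum>i\<le>k. monom (f (coeff P (k - i))) i)"

text \<open>Reflection w.r.t. (m,n): q~(z1,z2) = z1^m z2^n conj(q(1/conj z1, 1/conj z2)).\<close>
definition refl2 :: "nat \<Rightarrow> nat \<Rightarrow> complex poly poly \<Rightarrow> complex poly poly" where
  "refl2 m n Q = refl_gen n (refl_gen m cnj) Q"

text \<open>Reflection w.r.t. (m,n,1): p~(z) = z1^m z2^n z3 conj(p(1/conj z)).\<close>
definition refl3 :: "nat \<Rightarrow> nat \<Rightarrow> complex poly poly poly \<Rightarrow> complex poly poly poly" where
  "refl3 m n P = refl_gen 1 (refl2 m n) P"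

definition degz1 :: "complex poly poly poly \<Rightarrow> nat" where
  "degz1 P = Max (insert 0 (degree ` (\<Union>c\<in>set (coeffs P). set (coeffs c))))"

definition degz2 :: "complex poly poly poly \<Rightarrow> nat" where
  "degz2 P = Max (insert 0 (degree ` set (coeffs P)))"

definition degz3 :: "complex poly poly poly \<Rightarrow> nat" where
  "degz3 P = degree P"

definition rif2 :: "(complex \<Rightarrow> complex \<Rightarrow> complex) \<Rightarrow> bool" where
  "rif2 f \<longleftrightarrow>
     (\<exists>A B :: complex poly poly. B \<noteq> 0 \<and>
        (\<forall>z1\<in>ball 0 1. \<forall>z2\<in>ball 0 1. eval2 B z1 z2 \<noteq> 0 \<and> f z1 z2 = eval2 A z1 z2 / eval2 B z1 z2)) \<and>
     (AE x in (lborel :: (real \<times> real) measure).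
        \<exists>L. ((\<lambda>r. f (complex_of_real r * cis (fst x)) (complex_of_real r * cis (snd x))) \<longlongrightarrow> L) (at_left 1)
            \<and> norm L = 1)"

end

theory Submission
  imports Defs "HOL-Complex_Analysis.Complex_Analysis"
    "HOL-Computational_Algebra.Field_as_Ring"
begin

text \<open>On the torus the equation \<phi> = \<lambda> reads \<lambda> z3 q~ = q with |q~| = |q|, so over a point
  with q \<noteq> 0 it has the single solution z3 = \<Psi>, while over a zero of q it holds for every z3.
  Points of the graph of \<Psi> at which p vanishes are limits of points at which it does not: there
  |p1| = |p2|, and if this held on an open subset of the torus, p1 p1~ = p2 p2~ would be a
  polynomial identity, which by coprimality of p1 and p2 forces p to divide p~.

  The delicate case of (i) is a common zero \<tau> of p1 and p2 on the torus. For fixed unimodular z3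
  the polynomial G = \<lambda> z3 q~ - q is symmetric under reflection and has no zeros in the bidisc (or
  is 0), so by Hurwitz's theorem \<tau> is not an isolated zero of G on the torus; an eliminant of the
  coprime pair p1, p2 then yields zeros of G arbitrarily close to \<tau> where p1 and p2 do not both
  vanish. Freeness of zeros in the bidisc comes from the maximum principle: if B has no zeros there
  and |A| \<le> |B|, then |A~| \<le> |B|.\<close>

section \<open>Bivariate polynomials and their reflections\<close>

lemma eval2_0 [simp]: "eval2 0 z1 z2 = 0"
  by (simp add: eval2_def)

lemma eval2_pCons [simp]: "eval2 (pCons c Q) z1 z2 = poly c z1 + z2 * eval2 Q z1 z2"
  by (simp add: eval2_def map_poly_pCons)

lemma eval2_conv_poly: "eval2 Q z1 z2 = poly (poly Q [:z2:]) z1"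
  by (induction Q) auto

lemma eval2_add: "eval2 (P + Q) z1 z2 = eval2 P z1 z2 + eval2 Q z1 z2"
  and eval2_diff: "eval2 (P - Q) z1 z2 = eval2 P z1 z2 - eval2 Q z1 z2"
  and eval2_mult: "eval2 (P * Q) z1 z2 = eval2 P z1 z2 * eval2 Q z1 z2"
  by (simp_all add: eval2_conv_poly)

lemma eval2_const: "eval2 [:c:] z1 z2 = poly c z1"
  by simp

lemma eval3_linear: "eval3 [:p1, p2:] z1 z2 z3 = eval2 p1 z1 z2 + z3 * eval2 p2 z1 z2"
  by (simp add: eval3_def map_poly_pCons)

lemma eval2_continuous [continuous_intros]:
  assumes "continuous_on S f" "continuous_on S g"
  shows "continuous_on S (\<lambda>x. eval2 Q (f x) (g x))"
  using assms by (induction Q) (auto intro!: continuous_intros)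

lemma eval2_tendsto [tendsto_intros]:
  assumes "(f \<longlongrightarrow> a) F" "(g \<longlongrightarrow> b) F"
  shows "((\<lambda>x. eval2 Q (f x) (g x)) \<longlongrightarrow> eval2 Q a b) F"
  using assms by (induction Q) (auto intro!: tendsto_intros)

lemma eval2_holomorphic [holomorphic_intros]:
  assumes "f holomorphic_on S" "g holomorphic_on S"
  shows "(\<lambda>x. eval2 Q (f x) (g x)) holomorphic_on S"
  using assms
proof (induction Q)
  case (pCons a Q)
  have "(\<lambda>x. poly a (f x)) holomorphic_on S"
    by (induction a) (auto intro!: holomorphic_intros pCons.prems)
  then show ?case
    using pCons by (auto intro!: holomorphic_intros)
qed auto

text \<open>Root counting is applied twice: for fixed \<open>z2\<close> in \<open>S2\<close> the
  polynomial in \<open>z1\<close> has infinitely many roots, so every constant \<open>[:z2:]\<close>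
  is a root of \<open>Q\<close> itself.\<close>

lemma eval2_eq_0_imp_zero:
  assumes "infinite S1" "infinite S2" "\<And>z1 z2. z1 \<in> S1 \<Longrightarrow> z2 \<in> S2 \<Longrightarrow> eval2 Q z1 z2 = 0"
  shows "Q = 0"
proof (rule ccontr)
  assume "Q \<noteq> 0"
  have "poly Q [:z2:] = 0" if "z2 \<in> S2" for z2
  proof (rule ccontr)
    assume "poly Q [:z2:] \<noteq> 0"
    then have "finite {z. poly (poly Q [:z2:]) z = 0}"
      by (rule poly_roots_finite)
    moreover have "S1 \<subseteq> {z. poly (poly Q [:z2:]) z = 0}"
      using assms(3) that by (auto simp: eval2_conv_poly)
    ultimately show False
      using assms(1) finite_subset by blast
  qed
  then have "(\<lambda>z. [:z:]) ` S2 \<subseteq> {x. poly Q x = 0}"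
    by auto
  then have "finite ((\<lambda>z. [:z:]) ` S2)"
    using poly_roots_finite[OF \<open>Q \<noteq> 0\<close>] finite_subset by blast
  then show False
    using assms(2) by (auto dest!: finite_imageD simp: inj_on_def)
qed

text \<open>Translates vanishing on a whole line with fixed first coordinate into divisibility, so
  that coprimality can exclude it for two polynomials at once.\<close>

lemma eval2_slice_eq_0_iff:
  fixes Q :: "complex poly poly"
  shows "map_poly (\<lambda>c. poly c z1) Q = 0 \<longleftrightarrow> [:[:- z1, 1:]:] dvd Q"
  by (auto simp: poly_eq_iff coeff_map_poly const_poly_dvd_iff poly_eq_0_iff_dvd)

lemma finite_eval2_slice_eq_0:
  fixes Q :: "complex poly poly"
  assumes "Q \<noteq> 0"
  shows "finite {z1. map_poly (\<lambda>c. poly c z1) Q = 0}"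
proof -
  from assms obtain i where i: "coeff Q i \<noteq> 0"
    by (metis leading_coeff_0_iff)
  have "{z1. map_poly (\<lambda>c. poly c z1) Q = 0} \<subseteq> {z1. poly (coeff Q i) z1 = 0}"
    by (auto simp: poly_eq_iff coeff_map_poly)
  then show ?thesis
    using poly_roots_finite[OF i] finite_subset by blast
qed

text \<open>The circle is connected and has more than one point, hence has no isolated
  points.\<close>

lemma infinite_circle_ball:
  assumes "t \<in> sphere 0 1" "e > 0"
  shows "infinite (sphere 0 1 \<inter> ball (t::complex) e)"
proof -
  have "sphere 0 1 \<noteq> {x}" for x :: complex
  proof
    assume "sphere 0 1 = {x}"
    moreover have "(1::complex) \<in> sphere 0 1" "(-1::complex) \<in> sphere 0 1" by auto
    ultimately have "(1::complex) = -1" by (metis singletonD)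
    then show False by simp
  qed
  then have "t islimpt sphere 0 1"
    using connected_imp_perfect[of "sphere (0::complex) 1" t] assms(1)
    by (simp add: connected_sphere)
  then show ?thesis
    using assms(2) by (simp add: islimpt_eq_infinite_ball)
qed

text \<open>\<open>refl2 m n\<close> discards coefficients beyond bidegree (m,n); under this bound
  nothing is lost, and the analytic formula for the reflection holds.\<close>

definition bidegree_le :: "nat \<Rightarrow> nat \<Rightarrow> complex poly poly \<Rightarrow> bool" where
  "bidegree_le m n Q \<longleftrightarrow> degree Q \<le> n \<and> (\<forall>j. degree (coeff Q j) \<le> m)"

lemma degree_refl_gen: "degree (refl_gen k f P) \<le> k"
  unfolding refl_gen_def by (intro degree_sum_le) (auto intro: order.trans[OF degree_monom_le])

lemma coeff_refl_gen:
  "coeff (refl_gen k f P) j = (if j \<le> k then f (coeff P (k - j)) else 0)"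
  unfolding refl_gen_def by (simp add: coeff_sum coeff_monom sum.delta)

lemma bidegree_le_refl2: "bidegree_le m n (refl2 m n Q)"
  by (auto simp: bidegree_le_def refl2_def degree_refl_gen coeff_refl_gen)

lemma bidegree_le_diff: "bidegree_le m n P \<Longrightarrow> bidegree_le m n Q \<Longrightarrow> bidegree_le m n (P - Q)"
  by (auto simp: bidegree_le_def intro!: degree_diff_le)

lemma bidegree_le_const_mult: "bidegree_le m n Q \<Longrightarrow> bidegree_le m n ([:[:c:]:] * Q)"
  by (auto simp: bidegree_le_def intro: order.trans[OF degree_smult_le])

lemma poly_refl_gen_cnj:
  assumes "degree c \<le> m" "z \<noteq> 0"
  shows "poly (refl_gen m cnj c) z = z ^ m * cnj (poly c (1 / cnj z))"
proof -
  have "poly (refl_gen m cnj c) z = (\<Sum>i\<le>m. cnj (coeff c (m - i)) * z ^ i)"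
    by (simp add: refl_gen_def poly_sum poly_monom)
  also have "\<dots> = (\<Sum>i\<le>m. cnj (coeff c i) * z ^ (m - i))"
    by (rule sum.reindex_bij_witness[where i = "\<lambda>i. m - i" and j = "\<lambda>i. m - i"]) auto
  also have "\<dots> = (\<Sum>i\<le>m. z ^ m * (cnj (coeff c i) * (1 / z) ^ i))"
    using assms(2) by (intro sum.cong refl) (simp add: power_diff power_divide)
  also have "\<dots> = z ^ m * cnj (\<Sum>i\<le>m. coeff c i * (1 / cnj z) ^ i)"
    by (simp add: sum_distrib_left)
  also have "(\<Sum>i\<le>m. coeff c i * (1 / cnj z) ^ i) = poly c (1 / cnj z)"
    using assms(1) by (subst poly_altdef, intro sum.mono_neutral_right)
      (auto simp: coeff_eq_0)
  finally show ?thesis .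
qed

lemma eval2_refl2:
  assumes Q: "bidegree_le m n Q" and "z1 \<noteq> 0" "z2 \<noteq> 0"
  shows "eval2 (refl2 m n Q) z1 z2 = z1 ^ m * z2 ^ n * cnj (eval2 Q (1 / cnj z1) (1 / cnj z2))"
proof -
  have "map_poly (\<lambda>c. poly c z1) (refl2 m n Q)
      = smult (z1 ^ m) (refl_gen n cnj (map_poly (\<lambda>c. poly c (1 / cnj z1)) Q))"
    using assms
    by (auto simp: poly_eq_iff coeff_map_poly coeff_refl_gen refl2_def poly_refl_gen_cnj bidegree_le_def)
  moreover have "degree (map_poly (\<lambda>c. poly c (1 / cnj z1)) Q) \<le> n"
    using Q by (intro degree_le) (auto simp: bidegree_le_def coeff_map_poly coeff_eq_0)
  ultimately show ?thesis
    using assms(3) by (simp add: eval2_def poly_refl_gen_cnj)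
qed

text \<open>Reflection is an involution on polynomials of bidegree at most (m,n); this is that fact
  at the level of values.\<close>

lemma eval2_refl2_cnj:
  assumes "bidegree_le m n Q" "z1 \<noteq> 0" "z2 \<noteq> 0"
  shows "eval2 Q z1 z2 = z1 ^ m * z2 ^ n * cnj (eval2 (refl2 m n Q) (1 / cnj z1) (1 / cnj z2))"
  using assms by (subst eval2_refl2) (auto simp: power_divide)

lemma eval2_refl2_torus:
  assumes "bidegree_le m n Q" "z1 \<in> sphere 0 1" "z2 \<in> sphere 0 1"
  shows "eval2 (refl2 m n Q) z1 z2 = z1 ^ m * z2 ^ n * cnj (eval2 Q z1 z2)"
proof -
  have [simp]: "1 / cnj z = z" if "z \<in> sphere 0 1" for z
    using that complex_norm_square[of z] by (auto simp: divide_eq_eq)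
  have "z1 \<noteq> 0" "z2 \<noteq> 0" using assms by auto
  then show ?thesis
    using assms by (simp add: eval2_refl2)
qed

lemma norm_eval2_refl2_torus:
  assumes "bidegree_le m n Q" "z1 \<in> sphere 0 1" "z2 \<in> sphere 0 1"
  shows "norm (eval2 (refl2 m n Q) z1 z2) = norm (eval2 Q z1 z2)"
  using assms by (simp add: eval2_refl2_torus norm_mult norm_power)

lemma refl3_linear: "refl3 m n [:p1, p2:] = [:refl2 m n p2, refl2 m n p1:]"
  by (rule poly_eqI) (auto simp: refl3_def coeff_refl_gen coeff_pCons split: nat.split)

lemma degz_imp_bidegree_le:
  assumes "degz1 [:p1, p2:] = m" "degz2 [:p1, p2:] = n" "p2 \<noteq> 0"
  shows "bidegree_le m n p1" "bidegree_le m n p2"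
proof -
  have coeffs_P: "coeff [:p1, p2:] i \<in> set (coeffs [:p1, p2:])" if "coeff [:p1, p2:] i \<noteq> 0" for i
    using that by (metis coeff_0 coeff_in_coeffs le_degree)
  have "bidegree_le m n (coeff [:p1, p2:] i)" for i
  proof (cases "coeff [:p1, p2:] i = 0")
    case False
    then have *: "coeff [:p1, p2:] i \<in> set (coeffs [:p1, p2:])"
      by (rule coeffs_P)
    have "degree (coeff [:p1, p2:] i) \<le> n"
      unfolding assms(2)[symmetric] degz2_def using * by (intro Max_ge) auto
    moreover have "degree (coeff (coeff [:p1, p2:] i) j) \<le> m" for j
    proof (cases "coeff (coeff [:p1, p2:] i) j = 0")
      case False
      then have "coeff (coeff [:p1, p2:] i) j \<in> set (coeffs (coeff [:p1, p2:] i))"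
        by (intro coeff_in_coeffs) (auto simp: le_degree)
      with * show ?thesis
        unfolding assms(1)[symmetric] degz1_def by (intro Max_ge) blast+
    qed auto
    ultimately show ?thesis by (auto simp: bidegree_le_def)
  qed (auto simp: bidegree_le_def)
  from this[of 0] this[of 1] show "bidegree_le m n p1" "bidegree_le m n p2" by auto
qed

text \<open>The ring C[z1,z2] has no Bezout identity, but over the fraction field of C[z1] there is
  one; clearing denominators leaves a nonzero \<open>r\<close> in C[z1] alone. The proof takes an
  element \<open>h\<close> of the ideal of least degree in z2 and shows that its primitive part is a
  common divisor.\<close>

lemma coprime_imp_eliminant:
  fixes f g :: "complex poly poly"
  assumes "coprime f g" "f \<noteq> 0"
  obtains u v r where "r \<noteq> 0" "u * f + v * g = [:r:]"
proof -
  define I where "I = {h. h \<noteq> 0 \<and> (\<exists>u v. h = u * f + v * g)}"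
  have "f = 1 * f + 0 * g" by simp
  with assms(2) have "f \<in> I" unfolding I_def by blast
  then obtain h where h: "h \<in> I" "\<And>k. k \<in> I \<Longrightarrow> degree h \<le> degree k"
    using arg_min_natI[of "\<lambda>x. x \<in> I" f degree] arg_min_nat_le[of "\<lambda>x. x \<in> I" _ degree] by blast
  from h(1) obtain u v where uv: "h = u * f + v * g" and h0: "h \<noteq> 0"
    by (auto simp: I_def)
  have dvd: "primitive_part h dvd k" if k: "k = u' * f + v' * g" for k u' v'
  proof -
    obtain s r where sr: "pseudo_divmod k h = (s, r)" by force
    define c where "c = coeff h (degree h) ^ (Suc (degree k) - degree h)"
    have c0: "c \<noteq> 0" using h0 by (simp add: c_def)
    have eq: "smult c k = h * s + r" and r: "r = 0 \<or> degree r < degree h"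
      using pseudo_divmod[OF h0 sr] by (auto simp: c_def)
    \<comment> \<open>The pseudo-remainder stays in the ideal and has smaller degree than
      \<open>h\<close>, so minimality makes it zero.\<close>
    have "r = smult c k - h * s"
      using eq by simp
    also have "\<dots> = (smult c u' - s * u) * f + (smult c v' - s * v) * g"
      unfolding k uv by (simp add: algebra_simps smult_add_right)
    finally have "\<exists>u v. r = u * f + v * g"
      by blast
    then have "r = 0"
      using r h(2)[of r] unfolding I_def by force
    \<comment> \<open>\<open>h\<close> divides \<open>k\<close> only up to the factor
      \<open>c\<close>. Over the fraction field \<open>c\<close> is a unit, and Gauss's lemma for
      the primitive part brings divisibility back.\<close>
    then have "fract_poly h dvd smult (to_fract c) (fract_poly k)"
      using eq by (metis add.right_neutral dvd_triv_left fract_poly_dvd fract_poly_smult)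
    then have "fract_poly h dvd fract_poly k"
      using c0 by (simp add: dvd_smult_iff)
    moreover have "fract_poly (primitive_part h) dvd fract_poly h"
      by (intro fract_poly_dvd) (metis content_times_primitive_part dvd_refl dvd_smult)
    ultimately show ?thesis
      using h0 by (intro fract_poly_dvdD) (auto intro: dvd_trans)
  qed
  have "primitive_part h dvd f" by (rule dvd[of _ 1 0]) simp
  moreover have "primitive_part h dvd g" by (rule dvd[of _ 0 1]) simp
  ultimately have "is_unit (primitive_part h)"
    using assms(1) by (meson coprime_common_divisor)
  then have "degree h = 0"
    by (metis degree_primitive_part is_unit_iff_degree is_unit_polyE degree_pCons_0)
  then obtain r where "h = [:r:]" by (rule degree_eq_zeroE)
  with h0 have "r \<noteq> 0" by simp
  moreover have "u * f + v * g = [:r:]"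
    using uv \<open>h = [:r:]\<close> by simp
  ultimately show ?thesis by (rule that)
qed

section \<open>Zeros in the bidisc and on the torus\<close>

text \<open>A locally uniform limit of zero-free holomorphic functions is zero-free or identically
  zero. Joint continuity in parameter and variable supplies the uniform convergence.\<close>

lemma Hurwitz_parametric:
  fixes F :: "'a::heine_borel \<Rightarrow> complex \<Rightarrow> complex"
  assumes S: "open S" "connected S"
    and cont: "continuous_on UNIV (\<lambda>(a, z). F a z)"
    and hol: "\<And>a. F a holomorphic_on S"
    and X: "X \<longlonglongrightarrow> a"
    and nz: "\<And>k z. z \<in> S \<Longrightarrow> F (X k) z \<noteq> 0"
    and z0: "z0 \<in> S" "F a z0 = 0"
    and "z \<in> S"
  shows "F a z = 0"
proof (rule ccontr)
  assume "F a z \<noteq> 0"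
  have nonconst: "\<not> F a constant_on S"
  proof
    assume "F a constant_on S"
    then obtain y where "\<And>x. x \<in> S \<Longrightarrow> F a x = y"
      by (auto simp: constant_on_def)
    from this[OF \<open>z \<in> S\<close>] this[OF z0(1)] show False
      using z0(2) \<open>F a z \<noteq> 0\<close> by simp
  qed
  have "uniform_limit K (\<lambda>k. F (X k)) (F a) sequentially" if "compact K" for K
  proof (rule uniform_limitI)
    fix e :: real
    assume "e > 0"
    \<comment> \<open>A convergent sequence together with its limit is compact, so \<open>F\<close>
      is uniformly continuous on this product.\<close>
    have "compact (insert a (range X) \<times> K)"
      using X \<open>compact K\<close> by (intro compact_Times compact_sequence_with_limit)
    then have "uniformly_continuous_on (insert a (range X) \<times> K) (\<lambda>(a, z). F a z)"
      using cont by (intro compact_uniformly_continuous) (auto intro: continuous_on_subset)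
    then obtain d where "d > 0" and d:
      "\<And>x y. x \<in> insert a (range X) \<times> K \<Longrightarrow> y \<in> insert a (range X) \<times> K \<Longrightarrow> dist x y < d
        \<Longrightarrow> dist ((\<lambda>(a, z). F a z) x) ((\<lambda>(a, z). F a z) y) < e"
      using \<open>e > 0\<close> unfolding uniformly_continuous_on_def by metis
    have "\<forall>\<^sub>F k in sequentially. dist (X k) a < d"
      using X \<open>d > 0\<close> by (rule tendstoD)
    then show "\<forall>\<^sub>F k in sequentially. \<forall>z\<in>K. dist (F (X k) z) (F a z) < e"
    proof eventually_elim
      case (elim k)
      show ?case
        using d[of "(X k, _)" "(a, _)"] elim by (auto simp: dist_prod_def)
    qed
  qed
  then have "F a z0 \<noteq> 0"
    using hol nz by (intro Hurwitz_no_zeros[OF S, of "\<lambda>k. F (X k)" "F a"] nonconst z0(1)) auto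
  then show False
    using z0(2) by simp
qed

lemma max_modulus_unit_disc:
  assumes "f holomorphic_on ball 0 1" "continuous_on (cball 0 1) f"
    and "\<And>z. z \<in> sphere 0 1 \<Longrightarrow> norm (f z) \<le> B" and "z \<in> cball 0 1"
  shows "norm (f z) \<le> B"
  by (rule maximum_modulus_frontier[of f "cball 0 1"]) (use assms in auto)

lemma norm_eval2_refl2_le:
  assumes A: "bidegree_le m n A"
    and nz: "\<And>z1 z2. z1 \<in> ball 0 1 \<Longrightarrow> z2 \<in> ball 0 1 \<Longrightarrow> eval2 B z1 z2 \<noteq> 0"
    and le: "\<And>z1 z2. z1 \<in> ball 0 1 \<Longrightarrow> z2 \<in> ball 0 1 \<Longrightarrow> norm (eval2 A z1 z2) \<le> norm (eval2 B z1 z2)"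
    and w: "w1 \<in> ball 0 1" "w2 \<in> ball 0 1"
  shows "norm (eval2 (refl2 m n A) w1 w2) \<le> norm (eval2 B w1 w2)"
proof -
  \<comment> \<open>On the torus, r^(m+n) times the reflection of A at z/r is the reflection of z \<mapsto> A (r z);
    unlike the reflection of A itself it can be compared with B (r z), which has no zeros
    on the closed bidisc.\<close>
  define h where "h = (\<lambda>r z1 z2. of_real r ^ (m + n) * eval2 (refl2 m n A) (z1 / of_real r) (z2 / of_real r)
     / eval2 B (of_real r * z1) (of_real r * z2))"
  have h_le: "norm (h r w1 w2) \<le> 1" if r: "0 < r" "r < 1" for r
  proof -
    have in_ball: "of_real r * z \<in> ball (0::complex) 1" if "z \<in> cball 0 1" for z
    proof -
      have "norm (of_real r * z) = r * norm z" using r by (simp add: norm_mult)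
      also have "\<dots> \<le> r * 1" using that r by (intro mult_left_mono) auto
      finally show ?thesis using r by simp
    qed
    have nz': "eval2 B (of_real r * z1) (of_real r * z2) \<noteq> 0"
      if "z1 \<in> cball 0 1" "z2 \<in> cball 0 1" for z1 z2
      using nz in_ball that by blast
    have torus: "norm (h r t1 t2) \<le> 1" if t: "t1 \<in> sphere 0 1" "t2 \<in> sphere 0 1" for t1 t2
    proof -
      have inv: "1 / cnj (t / of_real r) = of_real r * t" if "t \<in> sphere 0 1" for t
      proof -
        have "t * cnj t = 1" using that complex_norm_square[of t] by auto
        then show ?thesis using r by (auto simp: divide_eq_eq eq_divide_eq ac_simps)
      qed
      have "norm (eval2 (refl2 m n A) (t1 / of_real r) (t2 / of_real r))
          = norm (eval2 A (of_real r * t1) (of_real r * t2)) / r ^ (m + n)"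
        using r t by (subst eval2_refl2[OF A])
          (auto simp: inv[OF t(1), simplified] inv[OF t(2), simplified] norm_mult norm_power norm_divide power_add power_divide)
      moreover have "norm (eval2 A (of_real r * t1) (of_real r * t2))
          \<le> norm (eval2 B (of_real r * t1) (of_real r * t2))"
        using t by (intro le in_ball) auto
      ultimately show ?thesis
        using nz'[of t1 t2] t r by (simp add: h_def norm_mult norm_divide norm_power divide_le_eq)
    qed
    \<comment> \<open>The bound spreads from the torus to the bidisc one variable at a time: first
      in \<open>z2\<close> with \<open>t1\<close> on the circle, then in the first variable.\<close>
    have edge: "norm (h r t1 z2) \<le> 1" if t: "t1 \<in> sphere 0 1" and z2: "z2 \<in> cball 0 1" for t1 z2
    proof (rule max_modulus_unit_disc[OF _ _ _ z2])
      show "h r t1 holomorphic_on ball 0 1"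
        unfolding h_def using r t nz' by (intro holomorphic_intros) auto
      show "continuous_on (cball 0 1) (h r t1)"
        unfolding h_def using r t nz' by (intro continuous_intros) auto
    qed (use torus t in auto)
    have w': "w1 \<in> cball 0 1" "w2 \<in> cball 0 1"
      using w by auto
    show ?thesis
    proof (rule max_modulus_unit_disc[where f = "\<lambda>z1. h r z1 w2", OF _ _ _ w'(1)])
      show "(\<lambda>z1. h r z1 w2) holomorphic_on ball 0 1"
        unfolding h_def using r w'(2) nz' by (intro holomorphic_intros) auto
      show "continuous_on (cball 0 1) (\<lambda>z1. h r z1 w2)"
        unfolding h_def using r w'(2) nz' by (intro continuous_intros) auto
    qed (use edge w' in auto)
  qed
  \<comment> \<open>Letting \<open>r\<close> tend to 1 removes the dilation.\<close>
  have "((\<lambda>r. h r w1 w2) \<longlongrightarrow> of_real 1 ^ (m + n) * eval2 (refl2 m n A) (w1 / of_real 1) (w2 / of_real 1)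
     / eval2 B (of_real 1 * w1) (of_real 1 * w2)) (at_left 1)"
    unfolding h_def using nz[OF w] by (intro tendsto_intros) auto
  then have lim: "((\<lambda>r. norm (h r w1 w2)) \<longlongrightarrow> norm (eval2 (refl2 m n A) w1 w2 / eval2 B w1 w2)) (at_left 1)"
    by (intro tendsto_norm) simp
  have "\<forall>\<^sub>F r in at_left 1. r \<in> {0<..<1::real}"
    by (rule eventually_at_left_real) simp
  then have "\<forall>\<^sub>F r in at_left 1. norm (h r w1 w2) \<le> 1"
    by eventually_elim (auto intro: h_le)
  with lim have "norm (eval2 (refl2 m n A) w1 w2 / eval2 B w1 w2) \<le> 1"
    by (rule tendsto_upperbound) auto
  then show ?thesis
    using nz[OF w] by (simp add: norm_divide divide_le_eq)
qed

text \<open>For |s| > 1 the function s c B - A~ has no zeros in the bidisc because |A~| \<le> |B|.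
  As s tends to 1, Hurwitz's theorem leaves only two options: still no zeros, or identically
  zero.\<close>

lemma zero_of_pencil_imp_eq:
  assumes A: "bidegree_le m n A"
    and nz: "\<And>z1 z2. z1 \<in> ball 0 1 \<Longrightarrow> z2 \<in> ball 0 1 \<Longrightarrow> eval2 B z1 z2 \<noteq> 0"
    and le: "\<And>z1 z2. z1 \<in> ball 0 1 \<Longrightarrow> z2 \<in> ball 0 1 \<Longrightarrow> norm (eval2 A z1 z2) \<le> norm (eval2 B z1 z2)"
    and c: "norm c = 1"
    and w: "w1 \<in> ball 0 1" "w2 \<in> ball 0 1" "c * eval2 B w1 w2 = eval2 (refl2 m n A) w1 w2"
  shows "[:[:c:]:] * B = refl2 m n A"
proof -
  define F where "F = (\<lambda>s z1 z2. s * c * eval2 B z1 z2 - eval2 (refl2 m n A) z1 z2)"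
  define X where "X = (\<lambda>k. 1 + of_real (inverse (real (Suc k))) :: complex)"
  have "X \<longlonglongrightarrow> 1 + of_real 0"
    unfolding X_def by (intro tendsto_intros LIMSEQ_inverse_real_of_nat)
  then have X: "X \<longlonglongrightarrow> 1" by simp
  have F_nz: "F (X k) z1 z2 \<noteq> 0" if z: "z1 \<in> ball 0 1" "z2 \<in> ball 0 1" for k z1 z2
  proof
    assume "F (X k) z1 z2 = 0"
    then have "norm (X k * c * eval2 B z1 z2) = norm (eval2 (refl2 m n A) z1 z2)"
      by (simp add: F_def)
    also have "\<dots> \<le> norm (eval2 B z1 z2)"
      using z by (intro norm_eval2_refl2_le A nz le)
    finally have "norm (X k) \<le> 1"
      using nz[OF z] c by (simp add: norm_mult)
    moreover have "X k = of_real (1 + inverse (real (Suc k)))"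
      by (simp add: X_def)
    then have "norm (X k) = \<bar>1 + inverse (real (Suc k))\<bar>"
      by (simp only: norm_of_real)
    moreover have "inverse (real (Suc k)) > 0" by simp
    ultimately show False by linarith
  qed
  \<comment> \<open>The zero at (\<open>w1\<close>, \<open>w2\<close>) spreads along the slice
    through \<open>w1\<close>, and from each point of that slice in the other direction.\<close>
  have slice: "F 1 w1 z2 = 0" if "z2 \<in> ball 0 1" for z2
  proof (rule Hurwitz_parametric[where S = "ball 0 1" and F = "\<lambda>s. F s w1" and X = X and ?z0.0 = w2])
    show "continuous_on UNIV (\<lambda>(a, z). F a w1 z)"
      unfolding F_def case_prod_unfold by (intro continuous_intros)
    show "F a w1 holomorphic_on ball 0 1" for a
      unfolding F_def by (intro holomorphic_intros)
  qed (use X F_nz w that in \<open>auto simp: F_def\<close>)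
  have all: "F 1 z1 z2 = 0" if z: "z1 \<in> ball 0 1" "z2 \<in> ball 0 1" for z1 z2
  proof (rule Hurwitz_parametric[where S = "ball 0 1" and F = "\<lambda>s z. F s z z2" and X = X and ?z0.0 = w1])
    show "continuous_on UNIV (\<lambda>(a, z). F a z z2)"
      unfolding F_def case_prod_unfold by (intro continuous_intros)
    show "(\<lambda>z. F a z z2) holomorphic_on ball 0 1" for a
      unfolding F_def by (intro holomorphic_intros)
  qed (use X F_nz w z slice in auto)
  have "infinite (ball 0 1 :: complex set)"
    by (simp add: uncountable_infinite uncountable_ball)
  then have "[:[:c:]:] * B - refl2 m n A = 0"
    using all by (intro eval2_eq_0_imp_zero[of "ball 0 1" "ball 0 1"])
      (auto simp: F_def eval2_diff eval2_mult eval2_const simp del: mult_pCons_left)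
  then show ?thesis by simp
qed

lemma slice_eq_0I:
  assumes "infinite S" "\<And>z. z \<in> S \<Longrightarrow> eval2 G t z = 0"
  shows "map_poly (\<lambda>c. poly c t) G = 0"
proof (rule ccontr)
  assume "map_poly (\<lambda>c. poly c t) G \<noteq> 0"
  then have "finite {z. eval2 G t z = 0}"
    unfolding eval2_def by (rule poly_roots_finite)
  then show False
    using assms finite_subset[of S "{z. eval2 G t z = 0}"] by auto
qed

text \<open>A polynomial with the reflection symmetry below has no isolated zeros on the torus.\<close>

lemma torus_zero_nearby:
  assumes nz: "\<And>z1 z2. z1 \<in> ball 0 1 \<Longrightarrow> z2 \<in> ball 0 1 \<Longrightarrow> eval2 G z1 z2 \<noteq> 0"
    and sym: "\<And>z1 z2. z1 \<in> sphere 0 1 \<Longrightarrow> z2 \<noteq> 0 \<Longrightarrow> eval2 G z1 z2 = 0 \<Longrightarrow> eval2 G z1 (1 / cnj z2) = 0"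
    and t: "t1 \<in> sphere 0 1" "t2 \<in> sphere 0 1" "eval2 G t1 t2 = 0"
    and slice: "map_poly (\<lambda>c. poly c t1) G \<noteq> 0"
    and "e > 0" and "finite N"
  obtains s1 s2 where "s1 \<in> sphere 0 1" "s2 \<in> sphere 0 1" "dist t1 s1 < e" "dist t2 s2 < e"
    "s1 \<notin> N" "eval2 G s1 s2 = 0"
proof -
  have "G \<noteq> 0"
    using slice by auto
  \<comment> \<open>Besides \<open>N\<close>, the finitely many first coordinates over which
    \<open>G\<close> vanishes identically must be avoided.\<close>
  define N' where "N' = N \<union> {s. map_poly (\<lambda>c. poly c s) G = 0}"
  have "finite N'"
    unfolding N'_def using \<open>finite N\<close> finite_eval2_slice_eq_0[OF \<open>G \<noteq> 0\<close>] by simp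
  have "\<exists>s. s \<in> (sphere 0 1 \<inter> ball t1 (e * inverse (real (Suc k)))) - N'" for k
  proof -
    have "infinite (sphere 0 1 \<inter> ball t1 (e * inverse (real (Suc k))))"
      using \<open>e > 0\<close> t by (intro infinite_circle_ball) auto
    then show ?thesis
      using \<open>finite N'\<close> by (metis Diff_infinite_finite ex_in_conv finite.emptyI)
  qed
  then obtain X where X: "\<And>k. X k \<in> (sphere 0 1 \<inter> ball t1 (e * inverse (real (Suc k)))) - N'"
    by metis
  have "(\<lambda>k. e * inverse (real (Suc k))) \<longlonglongrightarrow> e * 0"
    by (intro tendsto_intros LIMSEQ_inverse_real_of_nat)
  then have X_lim: "X \<longlonglongrightarrow> t1"
    using X by (intro metric_tendsto_imp_tendsto[of "\<lambda>k. e * inverse (real (Suc k))" 0 sequentially X t1])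
      (auto simp: dist_commute less_imp_le intro!: always_eventually order.trans[OF _ abs_ge_self])
  \<comment> \<open>The zero \<open>t2\<close> of the slice at \<open>t1\<close> persists on a
    nearby slice: otherwise Hurwitz's theorem would make the slice at \<open>t1\<close>
    vanish.\<close>
  have "\<exists>k. \<exists>s2\<in>ball t2 e. eval2 G (X k) s2 = 0"
  proof (rule ccontr)
    assume *: "\<not> (\<exists>k. \<exists>s2\<in>ball t2 e. eval2 G (X k) s2 = 0)"
    have "eval2 G t1 z = 0" if "z \<in> ball t2 e" for z
    proof (rule Hurwitz_parametric[where S = "ball t2 e" and F = "eval2 G" and X = X and ?z0.0 = t2])
      show "continuous_on UNIV (\<lambda>(a, z). eval2 G a z)"
        unfolding case_prod_unfold by (intro continuous_intros)
      show "eval2 G a holomorphic_on ball t2 e" for a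
        by (intro holomorphic_intros)
    qed (use * X_lim t \<open>e > 0\<close> that in auto)
    then show False
      using slice slice_eq_0I[of "ball t2 e"] \<open>e > 0\<close> by (auto simp: uncountable_infinite uncountable_ball)
  qed
  then obtain k s2 where s2: "s2 \<in> ball t2 e" "eval2 G (X k) s2 = 0"
    by blast
  \<comment> \<open>The slice over the boundary point \<open>X k\<close> is a radial limit of slices
    over interior points \<open>Y j\<close>, which are zero-free on the disc.\<close>
  have no_zero: "eval2 G (X k) z \<noteq> 0" if "z \<in> ball 0 1" for z
  proof
    assume z: "eval2 G (X k) z = 0"
    define Y where "Y = (\<lambda>j. (1 + of_real (- inverse (real (Suc j)))) * X k :: complex)"
    have "Y \<longlonglongrightarrow> (1 + of_real (- 0)) * X k"
      unfolding Y_def by (intro tendsto_intros LIMSEQ_inverse_real_of_nat)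
    then have Y_lim: "Y \<longlonglongrightarrow> X k"
      by simp
    have Y: "Y j \<in> ball 0 1" for j
    proof -
      have "Y j = of_real (1 + - inverse (real (Suc j))) * X k"
        by (simp add: Y_def)
      moreover have "norm (X k) = 1"
        using X[of k] by simp
      ultimately have "norm (Y j) = \<bar>1 + - inverse (real (Suc j))\<bar>"
        by (simp only: norm_mult norm_of_real mult_1_right)
      moreover have "inverse (real (Suc j)) > 0" "inverse (real (Suc j)) \<le> 1"
        by (auto simp: inverse_le_1_iff)
      ultimately have "norm (Y j) < 1"
        by linarith
      then show ?thesis
        by simp
    qed
    have "eval2 G (X k) u = 0" if "u \<in> ball 0 1" for u
    proof (rule Hurwitz_parametric[where S = "ball 0 1" and F = "eval2 G" and X = Y and ?z0.0 = z])
      show "continuous_on UNIV (\<lambda>(a, z). eval2 G a z)"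
        unfolding case_prod_unfold by (intro continuous_intros)
      show "eval2 G a holomorphic_on ball 0 1" for a
        by (intro holomorphic_intros)
      show "eval2 G (Y j) v \<noteq> 0" if "v \<in> ball 0 1" for j v
        using nz Y that by blast
    qed (use Y_lim z \<open>z \<in> ball 0 1\<close> that in \<open>simp_all\<close>)
    then have "map_poly (\<lambda>c. poly c (X k)) G = 0"
      by (intro slice_eq_0I[of "ball 0 1"]) (simp_all add: uncountable_infinite uncountable_ball)
    then show False
      using X[of k] unfolding N'_def by blast
  qed
  have "norm s2 \<ge> 1"
    using no_zero[of s2] s2 by (meson mem_ball_0 not_le)
  \<comment> \<open>The symmetry would turn a zero outside the closed disc into one inside.\<close>
  moreover have "\<not> norm s2 > 1"
  proof
    assume "norm s2 > 1"
    then have "1 / cnj s2 \<in> ball 0 1" "s2 \<noteq> 0"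
      by (auto simp: norm_divide divide_less_eq)
    moreover have "X k \<in> sphere 0 1"
      using X by blast
    ultimately show False
      using no_zero sym s2(2) by blast
  qed
  ultimately have "s2 \<in> sphere 0 1"
    by simp
  moreover have "dist t1 (X k) < e"
  proof -
    have "e * inverse (real (Suc k)) \<le> e * 1"
      using \<open>e > 0\<close> by (intro mult_left_mono) (auto simp: inverse_le_1_iff)
    moreover have "dist t1 (X k) < e * inverse (real (Suc k))"
      using X[of k] by (simp only: Int_iff Diff_iff mem_ball)
    ultimately show ?thesis by simp
  qed
  moreover have "X k \<in> sphere 0 1" "X k \<notin> N"
    using X[of k] unfolding N'_def by blast+
  ultimately show ?thesis
    using that[of "X k" s2] s2 by simp
qed

text \<open>Arcs around \<open>t1\<close> and \<open>t2\<close> are infinite, so a nonzero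
  polynomial cannot vanish on their product.\<close>

lemma torus_nonzero_nearby:
  assumes "Q \<noteq> 0" "t1 \<in> sphere 0 1" "t2 \<in> sphere 0 1" "e > 0"
  obtains s1 s2 where "s1 \<in> sphere 0 1" "s2 \<in> sphere 0 1" "dist t1 s1 < e" "dist t2 s2 < e"
    "eval2 Q s1 s2 \<noteq> 0"
proof -
  have "\<exists>s1\<in>sphere 0 1 \<inter> ball t1 e. \<exists>s2\<in>sphere 0 1 \<inter> ball t2 e. eval2 Q s1 s2 \<noteq> 0"
    using eval2_eq_0_imp_zero[OF infinite_circle_ball infinite_circle_ball, of t1 e t2 e Q] assms
    by blast
  then show ?thesis
    using that by auto
qed

section \<open>Null sets of angles on the torus\<close>

lemma countable_cis_vimage:
  assumes "finite S"
  shows "countable {x. cis x \<in> S}"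
proof -
  have "countable {x. cis x = z}" for z
  proof (cases "\<exists>y. cis y = z")
    case True
    then obtain y where y: "cis y = z" by blast
    have "{x. cis x = z} \<subseteq> range (\<lambda>k::int. y + 2 * pi * k)"
    proof
      fix x
      assume "x \<in> {x. cis x = z}"
      then have "sin x = sin y \<and> cos x = cos y"
        using y by (auto simp: complex_eq_iff)
      then show "x \<in> range (\<lambda>k::int. y + 2 * pi * k)"
        unfolding sin_cos_eq_iff by (auto simp: ac_simps)
    qed
    then show ?thesis
      by (rule countable_subset) simp
  qed auto
  moreover have "{x. cis x \<in> S} = (\<Union>z\<in>S. {x. cis x = z})"
    by auto
  ultimately show ?thesis
    using assms by (auto intro: countable_finite)
qed

text \<open>Fubini: outside countably many angles \<open>x\<close> the slice is a nonzero
  polynomial, whose finitely many roots account for only countably many angles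
  \<open>y\<close>.\<close>

lemma AE_torus_eval2_nonzero:
  assumes "Q \<noteq> 0"
  shows "AE x in (lborel :: (real \<times> real) measure). eval2 Q (cis (fst x)) (cis (snd x)) \<noteq> 0"
  unfolding lborel_prod[symmetric]
proof (rule lborel_pair.AE_pair_measure)
  have "open {x :: real \<times> real. eval2 Q (cis (fst x)) (cis (snd x)) \<noteq> 0}"
    by (intro open_Collect_neq continuous_intros)
  then show "{x \<in> space (lborel \<Otimes>\<^sub>M lborel). eval2 Q (cis (fst x)) (cis (snd x)) \<noteq> 0}
      \<in> sets (lborel \<Otimes>\<^sub>M lborel)"
    by (simp only: lborel_prod space_lborel space_borel UNIV_I simp_thms sets_lborel borel_open)
  have "AE x in lborel. cis x \<notin> {s. map_poly (\<lambda>c. poly c s) Q = 0}"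
    using AE_not_in[OF countable_imp_null_set_lborel[OF
      countable_cis_vimage[OF finite_eval2_slice_eq_0[OF assms]]]] by simp
  then show "AE x in lborel. AE y in lborel.
      eval2 Q (cis (fst (x, y))) (cis (snd (x, y))) \<noteq> 0"
  proof eventually_elim
    case (elim x)
    then have "finite {z. eval2 Q (cis x) z = 0}"
      unfolding eval2_def by (intro poly_roots_finite) auto
    from AE_not_in[OF countable_imp_null_set_lborel[OF countable_cis_vimage[OF this]]]
    show ?case by simp
  qed
qed

section \<open>Level sets of a rational inner function of degree (m,n,1)\<close>

locale rif_degree_mn1 =
  fixes p1 p2 :: "complex poly poly" and m n :: nat and lam :: complex
  assumes bidegree_p1: "bidegree_le m n p1" and bidegree_p2: "bidegree_le m n p2"
    and p2_nz: "p2 \<noteq> 0"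
    and zerofree: "\<And>z1 z2 z3. z1 \<in> ball 0 1 \<Longrightarrow> z2 \<in> ball 0 1 \<Longrightarrow> z3 \<in> ball 0 1 \<Longrightarrow>
      eval2 p1 z1 z2 + z3 * eval2 p2 z1 z2 \<noteq> 0"
    and coprime_refl: "coprime [:p1, p2:] [:refl2 m n p2, refl2 m n p1:]"
    and irred: "irreducible [:p1, p2:]"
    and norm_lam: "norm lam = 1"
begin

definition q :: "complex poly poly" where "q = [:[:lam:]:] * p1 - refl2 m n p2"

definition qt :: "complex poly poly" where "qt = refl2 m n q"

definition Psi :: "complex \<Rightarrow> complex \<Rightarrow> complex" where
  "Psi t1 t2 = cnj lam * eval2 q t1 t2 / eval2 qt t1 t2"

text \<open>The equation \<phi> = \<lambda> appears in the multiplied-out form justified by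
  \<open>level_eq_torus\<close>; this form still makes sense where \<open>p\<close> vanishes, so it
  survives passage to the closure.\<close>

definition level_set :: "(complex \<times> complex \<times> complex) set" where
  "level_set = {(t1, t2, t3). t1 \<in> sphere 0 1 \<and> t2 \<in> sphere 0 1 \<and> t3 \<in> sphere 0 1 \<and>
     eval2 p1 t1 t2 + t3 * eval2 p2 t1 t2 \<noteq> 0 \<and> lam * t3 * eval2 qt t1 t2 = eval2 q t1 t2}"

lemma lam_cnj [simp]: "lam * cnj lam = 1" "cnj lam * lam = 1"
  using norm_lam complex_norm_square[of lam] by (auto simp: mult.commute)

lemma lam_nz: "lam \<noteq> 0"
  using norm_lam by auto

lemma p1_nz: "z1 \<in> ball 0 1 \<Longrightarrow> z2 \<in> ball 0 1 \<Longrightarrow> eval2 p1 z1 z2 \<noteq> 0"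
  using zerofree[of z1 z2 0] by simp

text \<open>Otherwise \<open>z3\<close> = -p1/p2 would be a zero of \<open>p\<close> in the
  polydisc.\<close>

lemma norm_p2_le:
  assumes z: "z1 \<in> ball 0 1" "z2 \<in> ball 0 1"
  shows "norm (eval2 p2 z1 z2) \<le> norm (eval2 p1 z1 z2)"
proof (rule ccontr)
  assume *: "\<not> ?thesis"
  then have "eval2 p2 z1 z2 \<noteq> 0"
    by auto
  moreover have "- eval2 p1 z1 z2 / eval2 p2 z1 z2 \<in> ball 0 1"
    using * by (auto simp: norm_divide divide_less_eq)
  ultimately show False
    using zerofree[OF z, of "- eval2 p1 z1 z2 / eval2 p2 z1 z2"] by simp
qed

text \<open>A common factor of \<open>p1\<close> and \<open>p2\<close> divides \<open>p\<close> with
  a cofactor of degree 1 in z3; that cofactor is no unit, so irreducibility makes the factor a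
  unit.\<close>

lemma coprime_p1_p2: "coprime p1 p2"
proof (rule coprimeI)
  fix d
  assume "d dvd p1" "d dvd p2"
  then have "[:d:] dvd [:p1, p2:]"
    by (auto simp: const_poly_dvd_iff coeff_pCons split: nat.split)
  then obtain e where e: "[:p1, p2:] = [:d:] * e"
    by blast
  have "e \<noteq> 0" "[:d:] \<noteq> 0"
    using e p2_nz by auto
  then have "degree e = 1"
    using arg_cong[OF e, of degree] p2_nz by simp
  then have "\<not> is_unit e"
    by (auto simp: is_unit_poly_iff)
  with irreducibleD[OF irred e] show "is_unit d"
    by (simp add: is_unit_const_poly_iff)
qed

lemma p1_ne_0: "p1 \<noteq> 0"
  using p1_nz[of 0 0] by auto

lemma infinite_circle: "infinite (sphere 0 1 :: complex set)"
  using infinite_circle_ball[of 1 1] finite_subset[OF Int_lower1] by auto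

lemma eval2_q_torus:
  assumes "t1 \<in> sphere 0 1" "t2 \<in> sphere 0 1"
  shows "eval2 q t1 t2 = lam * eval2 p1 t1 t2 - t1 ^ m * t2 ^ n * cnj (eval2 p2 t1 t2)"
  using assms by (simp add: q_def eval2_diff eval2_mult eval2_refl2_torus bidegree_p2 del: mult_pCons_left)

lemma bidegree_q: "bidegree_le m n q"
  unfolding q_def by (intro bidegree_le_diff bidegree_le_const_mult bidegree_p1 bidegree_le_refl2)

lemma torus_monomial_cnj:
  assumes "t1 \<in> sphere 0 1" "t2 \<in> sphere 0 1"
  shows "t1 ^ m * t2 ^ n * cnj (t1 ^ m * t2 ^ n) = 1"
  using assms by (subst complex_norm_square[symmetric]) (simp add: norm_mult norm_power)

lemma eval2_qt_torus:
  assumes t: "t1 \<in> sphere 0 1" "t2 \<in> sphere 0 1"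
  shows "eval2 qt t1 t2 = cnj lam * eval2 (refl2 m n p1) t1 t2 - eval2 p2 t1 t2"
proof -
  define u where "u = t1 ^ m * t2 ^ n"
  have "eval2 qt t1 t2 = u * cnj (eval2 q t1 t2)"
    unfolding qt_def u_def by (rule eval2_refl2_torus[OF bidegree_q t])
  also have "\<dots> = cnj lam * (u * cnj (eval2 p1 t1 t2)) - (u * cnj u) * eval2 p2 t1 t2"
    unfolding eval2_q_torus[OF t] u_def by (simp add: algebra_simps)
  also have "u * cnj (eval2 p1 t1 t2) = eval2 (refl2 m n p1) t1 t2"
    unfolding u_def by (rule eval2_refl2_torus[OF bidegree_p1 t, symmetric])
  also have "u * cnj u = 1"
    unfolding u_def by (rule torus_monomial_cnj[OF t])
  finally show ?thesis by simp
qed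

lemma norm_qt_torus:
  assumes "t1 \<in> sphere 0 1" "t2 \<in> sphere 0 1"
  shows "norm (eval2 qt t1 t2) = norm (eval2 q t1 t2)"
  unfolding qt_def using bidegree_q assms by (rule norm_eval2_refl2_torus)

text \<open>Solving the formulas for \<open>q\<close> and \<open>qt\<close> for the reflections of
  \<open>p2\<close> and \<open>p1\<close> makes the terms of \<lambda> p cancel.\<close>

lemma level_eq_torus:
  assumes "t1 \<in> sphere 0 1" "t2 \<in> sphere 0 1"
  shows "eval2 (refl2 m n p2) t1 t2 + t3 * eval2 (refl2 m n p1) t1 t2
      = lam * (eval2 p1 t1 t2 + t3 * eval2 p2 t1 t2)
    \<longleftrightarrow> lam * t3 * eval2 qt t1 t2 = eval2 q t1 t2"
proof -
  have A: "eval2 (refl2 m n p2) t1 t2 = lam * eval2 p1 t1 t2 - eval2 q t1 t2"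
    by (simp add: q_def eval2_diff eval2_mult del: mult_pCons_left)
  have "lam * t3 * eval2 qt t1 t2
      = (lam * cnj lam) * t3 * eval2 (refl2 m n p1) t1 t2 - lam * t3 * eval2 p2 t1 t2"
    unfolding eval2_qt_torus[OF assms] by (simp only: algebra_simps)
  then have B: "t3 * eval2 (refl2 m n p1) t1 t2 = lam * t3 * eval2 qt t1 t2 + lam * t3 * eval2 p2 t1 t2"
    by simp
  show ?thesis
    unfolding A B by (auto simp: algebra_simps)
qed

text \<open>If it vanished, coprimality of \<open>p1\<close> and \<open>p2\<close> would give p2~ =
  c p1 and then p1~ = c p2. So \<open>p\<close> would divide its reflection, although it is coprime
  to it and not a unit.\<close>

lemma discriminant_ne_0: "p1 * refl2 m n p1 - p2 * refl2 m n p2 \<noteq> 0"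
proof
  assume "p1 * refl2 m n p1 - p2 * refl2 m n p2 = 0"
  then have eq: "p1 * refl2 m n p1 = p2 * refl2 m n p2"
    by simp
  then have "p1 dvd p2 * refl2 m n p2"
    by (metis dvd_triv_left)
  then have "p1 dvd refl2 m n p2"
    using coprime_p1_p2 by (simp add: coprime_dvd_mult_right_iff)
  then obtain c where c: "refl2 m n p2 = p1 * c"
    by blast
  then have "p1 * refl2 m n p1 = p1 * (p2 * c)"
    using eq by (simp add: ac_simps)
  then have "refl2 m n p1 = p2 * c"
    using p1_ne_0 by (metis mult_left_cancel)
  with c have "[:refl2 m n p2, refl2 m n p1:] = [:p1, p2:] * [:c:]"
    by (simp add: ac_simps)
  then have "[:p1, p2:] dvd [:refl2 m n p2, refl2 m n p1:]"
    by (rule dvdI)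
  then have "is_unit [:p1, p2:]"
    using coprime_refl by (meson coprime_common_divisor dvd_refl)
  then show False
    using irred by (simp add: irreducible_def)
qed

text \<open>On the torus the discriminant equals |p1|^2 - |p2|^2 up to a unimodular
  monomial.\<close>

lemma norm_p1_ne_norm_p2:
  assumes t: "t1 \<in> sphere 0 1" "t2 \<in> sphere 0 1"
    and nz: "eval2 (p1 * refl2 m n p1 - p2 * refl2 m n p2) t1 t2 \<noteq> 0"
  shows "norm (eval2 p1 t1 t2) \<noteq> norm (eval2 p2 t1 t2)"
proof
  assume eq: "norm (eval2 p1 t1 t2) = norm (eval2 p2 t1 t2)"
  have "eval2 (p1 * refl2 m n p1 - p2 * refl2 m n p2) t1 t2
      = t1 ^ m * t2 ^ n * (eval2 p1 t1 t2 * cnj (eval2 p1 t1 t2) - eval2 p2 t1 t2 * cnj (eval2 p2 t1 t2))"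
    using t by (simp add: eval2_diff eval2_mult eval2_refl2_torus bidegree_p1 bidegree_p2 algebra_simps)
  also have "\<dots> = 0"
    using eq by (simp flip: complex_norm_square)
  finally show False
    using nz by simp
qed

lemma q_zero_imp_norm_eq:
  assumes t: "t1 \<in> sphere 0 1" "t2 \<in> sphere 0 1" and "eval2 q t1 t2 = 0"
  shows "norm (eval2 p1 t1 t2) = norm (eval2 p2 t1 t2)"
proof -
  have "lam * eval2 p1 t1 t2 = t1 ^ m * t2 ^ n * cnj (eval2 p2 t1 t2)"
    using assms by (simp add: eval2_q_torus)
  then have "norm (lam * eval2 p1 t1 t2) = norm (t1 ^ m * t2 ^ n * cnj (eval2 p2 t1 t2))"
    by simp
  then show ?thesis
    using t norm_lam by (simp add: norm_mult norm_power)
qed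

lemma q_ne_0: "q \<noteq> 0"
proof
  assume "q = 0"
  then have "eval2 (p1 * refl2 m n p1 - p2 * refl2 m n p2) t1 t2 = 0"
    if "t1 \<in> sphere 0 1" "t2 \<in> sphere 0 1" for t1 t2
    using that q_zero_imp_norm_eq norm_p1_ne_norm_p2 by (metis eval2_0)
  then show False
    using eval2_eq_0_imp_zero[OF infinite_circle infinite_circle] discriminant_ne_0 by blast
qed

text \<open>This is the pencil lemma with A = \<open>p2\<close>, B = \<open>p1\<close> and c =
  \<open>lam\<close>: a single zero in the bidisc would force \<open>q\<close> = 0.\<close>

lemma q_zero_free:
  assumes z: "z1 \<in> ball 0 1" "z2 \<in> ball 0 1"
  shows "eval2 q z1 z2 \<noteq> 0"
proof
  assume "eval2 q z1 z2 = 0"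
  then have "lam * eval2 p1 z1 z2 = eval2 (refl2 m n p2) z1 z2"
    by (simp add: q_def eval2_diff eval2_mult del: mult_pCons_left)
  then have "[:[:lam:]:] * p1 = refl2 m n p2"
    using zero_of_pencil_imp_eq[OF bidegree_p2 p1_nz norm_p2_le norm_lam z] by blast
  then show False
    using q_ne_0 by (simp add: q_def)
qed

lemma norm_Psi:
  assumes "t1 \<in> sphere 0 1" "t2 \<in> sphere 0 1" "eval2 q t1 t2 \<noteq> 0"
  shows "norm (Psi t1 t2) = 1"
  using assms norm_lam by (simp add: Psi_def norm_mult norm_divide norm_qt_torus)

lemma eq_Psi_iff:
  assumes "t1 \<in> sphere 0 1" "t2 \<in> sphere 0 1" "eval2 q t1 t2 \<noteq> 0"
  shows "t3 = Psi t1 t2 \<longleftrightarrow> lam * t3 * eval2 qt t1 t2 = eval2 q t1 t2"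
proof -
  have "eval2 qt t1 t2 \<noteq> 0"
    using assms norm_qt_torus[of t1 t2] by auto
  then have "t3 = Psi t1 t2 \<longleftrightarrow> t3 * eval2 qt t1 t2 = cnj lam * eval2 q t1 t2"
    by (simp add: Psi_def nonzero_eq_divide_eq)
  also have "\<dots> \<longleftrightarrow> lam * (t3 * eval2 qt t1 t2) = lam * (cnj lam * eval2 q t1 t2)"
    using lam_nz by simp
  also have "lam * (cnj lam * eval2 q t1 t2) = eval2 q t1 t2"
    by (simp flip: mult.assoc)
  finally show ?thesis
    by (simp only: mult.assoc)
qed

lemma rif2_inverse_Psi: "rif2 (\<lambda>t1 t2. 1 / Psi t1 t2)"
proof -
  \<comment> \<open>With division by zero giving 0, the identity also holds where \<open>q\<close>
    or \<open>qt\<close> vanishes.\<close>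
  have Psi_eq: "1 / Psi t1 t2 = eval2 ([:[:lam:]:] * qt) t1 t2 / eval2 q t1 t2" for t1 t2
  proof -
    have "inverse (cnj lam) = lam"
      using lam_cnj(2) by (rule inverse_unique)
    then show ?thesis
      by (simp add: Psi_def eval2_mult divide_inverse ac_simps del: mult_pCons_left)
  qed
  have "AE x in (lborel :: (real \<times> real) measure). \<exists>L.
    ((\<lambda>r. 1 / Psi (complex_of_real r * cis (fst x)) (complex_of_real r * cis (snd x))) \<longlongrightarrow> L) (at_left 1)
      \<and> norm L = 1"
    \<comment> \<open>Off the null set of zeros of \<open>q\<close> the quotient is continuous up to
      the torus point, so the radial limit is its value there.\<close>
    using AE_torus_eval2_nonzero[OF q_ne_0]
  proof eventually_elim
    case (elim x)
    have "((\<lambda>r. 1 / Psi (complex_of_real r * cis (fst x)) (complex_of_real r * cis (snd x)))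
        \<longlongrightarrow> 1 / Psi (complex_of_real 1 * cis (fst x)) (complex_of_real 1 * cis (snd x))) (at_left 1)"
      unfolding Psi_eq using elim by (intro tendsto_intros) auto
    moreover have "norm (1 / Psi (complex_of_real 1 * cis (fst x)) (complex_of_real 1 * cis (snd x))) = 1"
      using norm_Psi[of "cis (fst x)" "cis (snd x)"] elim by (simp add: norm_divide)
    ultimately show ?case by blast
  qed
  then show ?thesis
    unfolding rif2_def using Psi_eq q_ne_0 q_zero_free
    by (intro conjI exI[of _ "[:[:lam:]:] * qt"] exI[of _ q]) auto
qed

section \<open>Points in the closure of the level set\<close>

lemma closure_level_set_subset:
  "closure level_set \<subseteq> {(t1, t2, t3). t1 \<in> sphere 0 1 \<and> t2 \<in> sphere 0 1 \<and> t3 \<in> sphere 0 1 \<and>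
     lam * t3 * eval2 qt t1 t2 = eval2 q t1 t2}"
proof (rule closure_minimal)
  have "closed {x. norm (fst x) = 1 \<and> norm (fst (snd x)) = 1 \<and> norm (snd (snd x)) = 1 \<and>
     lam * snd (snd x) * eval2 qt (fst x) (fst (snd x)) = eval2 q (fst x) (fst (snd x))}"
    by (intro closed_Collect_conj closed_Collect_eq continuous_intros)
  then show "closed {(t1, t2, t3). t1 \<in> sphere 0 1 \<and> t2 \<in> sphere 0 1 \<and> t3 \<in> sphere 0 1 \<and>
     lam * t3 * eval2 qt t1 t2 = eval2 q t1 t2}"
    by (simp add: case_prod_unfold)
qed (auto simp: level_set_def)

text \<open>Nearby torus points with nonzero discriminant have |p1| \<noteq> |p2|; since
  \<open>Psi\<close> is unimodular, \<open>p\<close> cannot vanish on the graph over them.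
  Continuity of \<open>Psi\<close> where \<open>qt\<close> is nonzero gives the limit.\<close>

lemma graph_in_closure_level_set:
  assumes t: "t1 \<in> sphere 0 1" "t2 \<in> sphere 0 1" and q_nz: "eval2 q t1 t2 \<noteq> 0"
  shows "(t1, t2, Psi t1 t2) \<in> closure level_set"
proof -
  define near where "near = (\<lambda>k s. fst s \<in> sphere 0 1 \<and> snd s \<in> sphere 0 1 \<and>
      dist t1 (fst s) < inverse (real (Suc k)) \<and> dist t2 (snd s) < inverse (real (Suc k)) \<and>
      eval2 (p1 * refl2 m n p1 - p2 * refl2 m n p2) (fst s) (snd s) \<noteq> 0)"
  have "\<exists>s. near k s" for k
  proof -
    have "inverse (real (Suc k)) > 0" by simp
    then obtain s1 s2 where "s1 \<in> sphere 0 1" "s2 \<in> sphere 0 1"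
      "dist t1 s1 < inverse (real (Suc k))" "dist t2 s2 < inverse (real (Suc k))"
      "eval2 (p1 * refl2 m n p1 - p2 * refl2 m n p2) s1 s2 \<noteq> 0"
      by (rule torus_nonzero_nearby[OF discriminant_ne_0 t])
    then have "near k (s1, s2)"
      unfolding near_def fst_conv snd_conv by blast
    then show ?thesis ..
  qed
  then obtain s where "\<And>k. near k (s k)"
    by metis
  then have s: "fst (s k) \<in> sphere 0 1" "snd (s k) \<in> sphere 0 1"
      "dist t1 (fst (s k)) < inverse (real (Suc k))"
      "dist t2 (snd (s k)) < inverse (real (Suc k))"
      "eval2 (p1 * refl2 m n p1 - p2 * refl2 m n p2) (fst (s k)) (snd (s k)) \<noteq> 0" for k
    unfolding near_def by blast+
  have "(\<lambda>k. dist (fst (s k)) t1) \<longlonglongrightarrow> 0" "(\<lambda>k. dist (snd (s k)) t2) \<longlonglongrightarrow> 0"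
    using s(3,4) by (auto intro!: tendsto_sandwich[OF _ _ tendsto_const LIMSEQ_inverse_real_of_nat]
      always_eventually simp: dist_commute less_imp_le simp del: of_nat_Suc)
  then have lim: "(\<lambda>k. fst (s k)) \<longlonglongrightarrow> t1" "(\<lambda>k. snd (s k)) \<longlonglongrightarrow> t2"
    by (auto intro: tendsto_dist_iff[THEN iffD2])
  have "eval2 qt t1 t2 \<noteq> 0"
    using q_nz norm_qt_torus[OF t] by auto
  then have Psi_lim: "(\<lambda>k. (fst (s k), snd (s k), Psi (fst (s k)) (snd (s k)))) \<longlonglongrightarrow> (t1, t2, Psi t1 t2)"
    unfolding Psi_def by (intro tendsto_intros lim)
  have "(\<lambda>k. eval2 q (fst (s k)) (snd (s k))) \<longlonglongrightarrow> eval2 q t1 t2"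
    by (intro tendsto_intros lim)
  then have "\<forall>\<^sub>F k in sequentially. eval2 q (fst (s k)) (snd (s k)) \<noteq> 0"
    using q_nz by (rule tendsto_imp_eventually_ne)
  then have "\<forall>\<^sub>F k in sequentially. (fst (s k), snd (s k), Psi (fst (s k)) (snd (s k))) \<in> closure level_set"
  proof eventually_elim
    case (elim k)
    let ?P = "Psi (fst (s k)) (snd (s k))"
    have P: "norm ?P = 1"
      using elim s by (intro norm_Psi)
    have "eval2 p1 (fst (s k)) (snd (s k)) + ?P * eval2 p2 (fst (s k)) (snd (s k)) \<noteq> 0"
    proof
      assume "eval2 p1 (fst (s k)) (snd (s k)) + ?P * eval2 p2 (fst (s k)) (snd (s k)) = 0"
      then have "norm (eval2 p1 (fst (s k)) (snd (s k))) = norm (?P * eval2 p2 (fst (s k)) (snd (s k)))"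
        unfolding eq_neg_iff_add_eq_0[symmetric] by (simp only: norm_minus_cancel)
      then show False
        using norm_p1_ne_norm_p2[OF s(1,2,5)] P by (simp add: norm_mult)
    qed
    then have "(fst (s k), snd (s k), ?P) \<in> level_set"
      using s elim P eq_Psi_iff[OF s(1,2) elim, of ?P] by (auto simp: level_set_def)
    then show ?case
      using closure_subset by blast
  qed
  then show ?thesis
    using Psi_lim by (intro Lim_in_closed_set[OF closed_closure]) auto
qed

text \<open>Over a zero of \<open>q\<close> also \<open>qt\<close> vanishes, so the level equation
  holds for every third coordinate. As \<open>p2\<close> is nonzero there, \<open>p\<close> vanishes
  for only one value of it.\<close>

lemma fiber_in_closure_level_set:
  assumes t: "t1 \<in> sphere 0 1" "t2 \<in> sphere 0 1" "t3 \<in> sphere 0 1"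
    and q0: "eval2 q t1 t2 = 0"
    and nz: "eval2 p1 t1 t2 \<noteq> 0 \<or> eval2 p2 t1 t2 \<noteq> 0"
  shows "(t1, t2, t3) \<in> closure level_set"
proof -
  have p2_nz: "eval2 p2 t1 t2 \<noteq> 0"
    using q_zero_imp_norm_eq[OF t(1,2) q0] nz by auto
  have qt0: "eval2 qt t1 t2 = 0"
    using q0 norm_qt_torus[OF t(1,2)] by auto
  have "\<exists>s\<in>level_set. dist s (t1, t2, t3) < e" if "e > 0" for e
  proof -
    have "infinite (sphere 0 1 \<inter> ball t3 e - {- eval2 p1 t1 t2 / eval2 p2 t1 t2})"
      using infinite_circle_ball[OF t(3) that] by simp
    then obtain s where "s \<in> sphere 0 1 \<inter> ball t3 e - {- eval2 p1 t1 t2 / eval2 p2 t1 t2}"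
      using infinite_imp_nonempty by blast
    then have s: "s \<in> sphere 0 1" "dist t3 s < e" "s \<noteq> - eval2 p1 t1 t2 / eval2 p2 t1 t2"
      by auto
    have "eval2 p1 t1 t2 + s * eval2 p2 t1 t2 \<noteq> 0"
    proof
      assume "eval2 p1 t1 t2 + s * eval2 p2 t1 t2 = 0"
      then have "s * eval2 p2 t1 t2 = - eval2 p1 t1 t2"
        by (simp add: eq_neg_iff_add_eq_0 add.commute)
      then have "s = - eval2 p1 t1 t2 / eval2 p2 t1 t2"
        by (rule nonzero_eq_divide_eq[OF p2_nz, THEN iffD2])
      with s(3) show False
        by contradiction
    qed
    then have "(t1, t2, s) \<in> level_set"
      using t s q0 qt0 by (auto simp: level_set_def)
    then show ?thesis
      using s by (intro bexI[of _ "(t1, t2, s)"]) (auto simp: dist_Pair_Pair dist_commute)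
  qed
  then show ?thesis
    unfolding closure_approachable by blast
qed

lemma nondegenerate_in_closure_level_set:
  assumes "t1 \<in> sphere 0 1" "t2 \<in> sphere 0 1" "t3 \<in> sphere 0 1"
    and "lam * t3 * eval2 qt t1 t2 = eval2 q t1 t2"
    and "eval2 p1 t1 t2 \<noteq> 0 \<or> eval2 p2 t1 t2 \<noteq> 0"
  shows "(t1, t2, t3) \<in> closure level_set"
proof (cases "eval2 q t1 t2 = 0")
  case True
  then show ?thesis using assms fiber_in_closure_level_set by blast
next
  case False
  then have "t3 = Psi t1 t2"
    using assms eq_Psi_iff by blast
  then show ?thesis
    using False assms graph_in_closure_level_set by blast
qed

text \<open>The first coordinate of a common zero is a root of the eliminant.\<close>

lemma common_zero_slice_finite: "finite {t1. \<exists>t2. eval2 p1 t1 t2 = 0 \<and> eval2 p2 t1 t2 = 0}"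
proof -
  obtain u v r where r: "r \<noteq> 0" "u * p1 + v * p2 = [:r:]"
    by (rule coprime_imp_eliminant[OF coprime_p1_p2 p1_ne_0])
  have "poly r t1 = 0" if "eval2 p1 t1 t2 = 0" "eval2 p2 t1 t2 = 0" for t1 t2
    using arg_cong[OF r(2), of "\<lambda>Q. eval2 Q t1 t2"] that by (simp add: eval2_add eval2_mult)
  then have "{t1. \<exists>t2. eval2 p1 t1 t2 = 0 \<and> eval2 p2 t1 t2 = 0} \<subseteq> {t1. poly r t1 = 0}"
    by auto
  then show ?thesis
    by (rule finite_subset) (rule poly_roots_finite[OF r(1)])
qed

text \<open>The third coordinate stays fixed while (\<open>t1\<close>, \<open>t2\<close>) moves
  inside the zero set of \<open>G\<close> on the torus, away from the common zeros of
  \<open>p1\<close> and \<open>p2\<close>.\<close>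

lemma nondegenerate_level_point_nearby:
  assumes t: "t1 \<in> sphere 0 1" "t2 \<in> sphere 0 1" "t3 \<in> sphere 0 1"
    and q0: "eval2 q t1 t2 = 0" and "e > 0"
  obtains s1 s2 where "s1 \<in> sphere 0 1" "s2 \<in> sphere 0 1" "dist t1 s1 < e" "dist t2 s2 < e"
    "lam * t3 * eval2 qt s1 s2 = eval2 q s1 s2" "eval2 p1 s1 s2 \<noteq> 0 \<or> eval2 p2 s1 s2 \<noteq> 0"
proof -
  define G where "G = [:[:lam * t3:]:] * qt - q"
  have eval_G: "eval2 G z1 z2 = lam * t3 * eval2 qt z1 z2 - eval2 q z1 z2" for z1 z2
    by (simp add: G_def eval2_diff eval2_mult del: mult_pCons_left)
  have norm_lt: "norm (lam * t3) = 1"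
    using norm_lam t by (simp add: norm_mult)
  then have cnj_lt: "cnj (lam * t3) * (lam * t3) = 1"
    using complex_norm_square[of "lam * t3"] by (simp add: mult.commute)
  show ?thesis
  proof (cases "map_poly (\<lambda>c. poly c t1) G = 0")
    case True
    \<comment> \<open>Here \<open>G\<close> vanishes on the whole line over \<open>t1\<close>, so
      moving \<open>t2\<close> suffices, provided that this line holds only finitely many common
      zeros.\<close>
    have "map_poly (\<lambda>c. poly c t1) p1 \<noteq> 0 \<or> map_poly (\<lambda>c. poly c t1) p2 \<noteq> 0"
    proof (rule ccontr)
      assume "\<not> ?thesis"
      then have "[:[:- t1, 1:]:] dvd p1" "[:[:- t1, 1:]:] dvd p2"
        unfolding eval2_slice_eq_0_iff by auto
      then have "is_unit [:[:- t1, 1:]:]"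
        using coprime_p1_p2 by (meson coprime_common_divisor)
      then show False
        by (auto simp: is_unit_const_poly_iff is_unit_poly_iff)
    qed
    then have "finite {s. eval2 p1 t1 s = 0} \<or> finite {s. eval2 p2 t1 s = 0}"
      unfolding eval2_def using poly_roots_finite by blast
    then have "finite {s. eval2 p1 t1 s = 0 \<and> eval2 p2 t1 s = 0}"
      by (auto intro: finite_subset[rotated])
    then have "infinite ((sphere 0 1 \<inter> ball t2 e) - {s. eval2 p1 t1 s = 0 \<and> eval2 p2 t1 s = 0})"
      using infinite_circle_ball[OF t(2) \<open>e > 0\<close>] by (rule Diff_infinite_finite)
    then obtain s where "s \<in> (sphere 0 1 \<inter> ball t2 e) - {s. eval2 p1 t1 s = 0 \<and> eval2 p2 t1 s = 0}"
      using infinite_imp_nonempty by blast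
    moreover have "eval2 G t1 s = 0"
      using True by (simp add: eval2_def)
    ultimately show ?thesis
      using that[of t1 s] t \<open>e > 0\<close> by (auto simp: eval_G)
  next
    case False
    \<comment> \<open>The pencil lemma with A = B = \<open>q\<close>: a zero would make
      \<open>qt\<close> a unimodular multiple of \<open>q\<close>, and then \<open>G\<close> = 0
      against the case assumption.\<close>
    have nz: "eval2 G z1 z2 \<noteq> 0" if z: "z1 \<in> ball 0 1" "z2 \<in> ball 0 1" for z1 z2
    proof
      assume "eval2 G z1 z2 = 0"
      then have "eval2 q z1 z2 = lam * t3 * eval2 qt z1 z2"
        by (simp add: eval_G)
      then have "cnj (lam * t3) * eval2 q z1 z2 = (cnj (lam * t3) * (lam * t3)) * eval2 qt z1 z2"
        by (simp only: mult.assoc)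
      then have "cnj (lam * t3) * eval2 q z1 z2 = eval2 (refl2 m n q) z1 z2"
        unfolding cnj_lt qt_def by simp
      moreover have "norm (cnj (lam * t3)) = 1"
        using norm_lt by (simp only: complex_mod_cnj)
      ultimately have eq: "[:[:cnj (lam * t3):]:] * q = qt"
        unfolding qt_def using zero_of_pencil_imp_eq[OF bidegree_q q_zero_free order.refl _ z] by blast
      have "G = [:[:lam * t3:]:] * ([:[:cnj (lam * t3):]:] * q) - q"
        unfolding G_def eq ..
      also have "\<dots> = 0"
        using cnj_lt by (simp add: mult.commute flip: one_pCons)
      finally show False
        using False by simp
    qed
    \<comment> \<open>Reflection fixes a unimodular \<open>z1\<close> and exchanges \<open>q\<close>
      and \<open>qt\<close>, hence preserves the zeros of \<open>G\<close>.\<close>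
    have sym: "eval2 G z1 (1 / cnj z2) = 0"
      if z: "z1 \<in> sphere 0 1" "z2 \<noteq> 0" "eval2 G z1 z2 = 0" for z1 z2
    proof -
      have "z1 \<noteq> 0" "1 / cnj z1 = z1"
        using z(1) complex_norm_square[of z1] by (auto simp: divide_eq_eq)
      let ?w = "1 / cnj z2"
      let ?M = "z1 ^ m * z2 ^ n"
      have "?M \<noteq> 0"
        using \<open>z1 \<noteq> 0\<close> z(2) by simp
      have "eval2 qt z1 z2 = ?M * cnj (eval2 q z1 ?w)"
        using eval2_refl2[OF bidegree_q \<open>z1 \<noteq> 0\<close> z(2)] \<open>1 / cnj z1 = z1\<close> by (simp add: qt_def)
      moreover have "eval2 q z1 z2 = ?M * cnj (eval2 qt z1 ?w)"
        using eval2_refl2_cnj[OF bidegree_q \<open>z1 \<noteq> 0\<close> z(2)] \<open>1 / cnj z1 = z1\<close> by (simp add: qt_def)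
      ultimately have "?M * (lam * t3 * cnj (eval2 q z1 ?w)) = ?M * cnj (eval2 qt z1 ?w)"
        using z(3) by (simp add: eval_G ac_simps)
      then have "lam * t3 * cnj (eval2 q z1 ?w) = cnj (eval2 qt z1 ?w)"
        by (rule mult_left_cancel[OF \<open>?M \<noteq> 0\<close>, THEN iffD1])
      then have "cnj (lam * t3 * cnj (eval2 q z1 ?w)) = cnj (cnj (eval2 qt z1 ?w))"
        by (rule arg_cong)
      then have "eval2 qt z1 ?w = cnj (lam * t3) * eval2 q z1 ?w"
        by simp
      then have "lam * t3 * eval2 qt z1 ?w = (cnj (lam * t3) * (lam * t3)) * eval2 q z1 ?w"
        by (simp only: ac_simps)
      then show ?thesis
        unfolding eval_G cnj_lt by simp
    qed
    have "eval2 G t1 t2 = 0"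
      using q0 norm_qt_torus[OF t(1,2)] by (simp add: eval_G)
    obtain s1 s2 where "s1 \<in> sphere 0 1" "s2 \<in> sphere 0 1" "dist t1 s1 < e" "dist t2 s2 < e"
      "s1 \<notin> {t1. \<exists>t2. eval2 p1 t1 t2 = 0 \<and> eval2 p2 t1 t2 = 0}" "eval2 G s1 s2 = 0"
      by (rule torus_zero_nearby[OF nz sym t(1,2) \<open>eval2 G t1 t2 = 0\<close> False \<open>e > 0\<close> common_zero_slice_finite])
    then show ?thesis
      using that[of s1 s2] by (auto simp: eval_G)
  qed
qed

text \<open>Points of the closure are found arbitrarily near, with the same third coordinate;
  closing up a second time adds nothing.\<close>

lemma vertical_line_in_closure_level_set:
  assumes t: "t1 \<in> sphere 0 1" "t2 \<in> sphere 0 1" "t3 \<in> sphere 0 1" and q0: "eval2 q t1 t2 = 0"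
  shows "(t1, t2, t3) \<in> closure level_set"
proof -
  have "\<exists>s\<in>closure level_set. dist s (t1, t2, t3) < e" if "e > 0" for e
  proof -
    from that have "e / 2 > 0" by simp
    from nondegenerate_level_point_nearby[OF t q0 this]
    obtain s1 s2 where s: "s1 \<in> sphere 0 1" "s2 \<in> sphere 0 1" "dist t1 s1 < e / 2" "dist t2 s2 < e / 2"
      "lam * t3 * eval2 qt s1 s2 = eval2 q s1 s2" "eval2 p1 s1 s2 \<noteq> 0 \<or> eval2 p2 s1 s2 \<noteq> 0"
      by metis
    have "dist (s1, s2, t3) (t1, t2, t3) \<le> dist s1 t1 + dist s2 t2"
      by (simp add: dist_Pair_Pair sqrt_sum_squares_le_sum)
    also have "\<dots> < e"
      using s(3,4) by (simp add: dist_commute)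
    finally show ?thesis
      using nondegenerate_in_closure_level_set[OF s(1,2) t(3) s(5,6)] by blast
  qed
  then have "(t1, t2, t3) \<in> closure (closure level_set)"
    unfolding closure_approachable by blast
  then show ?thesis by simp
qed

lemma closure_level_set_diff:
  "closure level_set - {(t1, t2, t3). t1 \<in> sphere 0 1 \<and> t2 \<in> sphere 0 1 \<and> eval2 q t1 t2 = 0 \<and> t3 \<in> sphere 0 1}
    = {(t1, t2, Psi t1 t2) | t1 t2. t1 \<in> sphere 0 1 \<and> t2 \<in> sphere 0 1 \<and> eval2 q t1 t2 \<noteq> 0}"
    (is "?L = ?R")
proof
  show "?L \<subseteq> ?R"
    using closure_level_set_subset eq_Psi_iff by fast
  show "?R \<subseteq> ?L"
    using graph_in_closure_level_set by auto
qed

end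

theorem theorem4p6:
  fixes p1 p2 :: "complex poly poly" and m n :: nat and lam :: complex
  assumes deg: "degz1 [:p1, p2:] = m" "degz2 [:p1, p2:] = n" "degz3 [:p1, p2:] = 1"
    and zerofree: "\<forall>z1\<in>ball 0 1. \<forall>z2\<in>ball 0 1. \<forall>z3\<in>ball 0 1. eval3 [:p1, p2:] z1 z2 z3 \<noteq> 0"
    and coprime: "coprime [:p1, p2:] (refl3 m n [:p1, p2:])"
    and irred: "irreducible [:p1, p2:]"
    and lam: "lam \<in> sphere 0 1"
  shows
    "let p = [:p1, p2:];
         pt = refl3 m n p;
         phi = (\<lambda>(z1, z2, z3). eval3 pt z1 z2 z3 / eval3 p z1 z2 z3);
         q = [:[:lam:]:] * p1 - refl2 m n p2;
         qt = refl2 m n q;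
         Psi = (\<lambda>t1 t2. cnj lam * eval2 q t1 t2 / eval2 qt t1 t2);
         C = closure {(z1, z2, z3). z1 \<in> sphere 0 1 \<and> z2 \<in> sphere 0 1 \<and> z3 \<in> sphere 0 1 \<and>
                        eval3 p z1 z2 z3 \<noteq> 0 \<and> phi (z1, z2, z3) = lam};
         Zq = {(t1, t2, t3). t1 \<in> sphere 0 1 \<and> t2 \<in> sphere 0 1 \<and> eval2 q t1 t2 = 0 \<and> t3 \<in> sphere 0 1}
     in Zq \<subseteq> C \<and>
        rif2 (\<lambda>t1 t2. 1 / Psi t1 t2) \<and>
        C - Zq = {(t1, t2, Psi t1 t2) | t1 t2. t1 \<in> sphere 0 1 \<and> t2 \<in> sphere 0 1 \<and> eval2 q t1 t2 \<noteq> 0}"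
proof -
  have "p2 \<noteq> 0"
    using deg(3) by (auto simp: degz3_def)
  interpret rif_degree_mn1 p1 p2 m n lam
    using degz_imp_bidegree_le[OF deg(1,2) \<open>p2 \<noteq> 0\<close>] \<open>p2 \<noteq> 0\<close> zerofree coprime irred lam
    by unfold_locales (simp_all add: eval3_linear refl3_linear)
  \<comment> \<open>The condition that \<open>p\<close> is nonzero allows clearing the denominator
    of \<phi>.\<close>
  have level_set_eq: "{(z1, z2, z3). z1 \<in> sphere 0 1 \<and> z2 \<in> sphere 0 1 \<and> z3 \<in> sphere 0 1 \<and>
      eval3 [:p1, p2:] z1 z2 z3 \<noteq> 0 \<and>
      (\<lambda>(z1, z2, z3). eval3 (refl3 m n [:p1, p2:]) z1 z2 z3 / eval3 [:p1, p2:] z1 z2 z3) (z1, z2, z3) = lam}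
    = level_set"
    using level_eq_torus
    by (auto simp: level_set_def eval3_linear refl3_linear divide_eq_eq mult.commute)
  show ?thesis
    unfolding Let_def level_set_eq q_def[symmetric] qt_def[symmetric] Psi_def[symmetric]
    using vertical_line_in_closure_level_set rif2_inverse_Psi closure_level_set_diff by auto
qed

end
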